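(* For $m\ge1$ let $G_m$ be the graph with the $m+2$ vertices $0,1,\dots,m+1$ and the $n=2m$ edges $\{0,i\}$ and $\{i,m+1\}$, $1\le i\le m$. Let $M_0,M_1,\dots,M_{m+1}$ be i.i.d. $\mathrm{Bernoulli}(1/2)$ random variables assigned to the vertices. For each edge $\{i,j\}$ of $G_m$ let $D_{i,j}=1$ if $M_i=M_j$ and $D_{i,j}=0$ otherwise, let $\Xi_n$ be the sum of the $n$ variables $D_{i,j}$ over all edges of $G_m$, and let $$\xi_n=\frac{\Xi_n-n/2}{\sqrt{n/4}}.$$ Then $$\xi_n\ \xrightarrow{\ \mathrm{law}\ }\ \sqrt2\,I\cdot Z,\qquad\text{as } m\to\infty\text{ (and thus as } n\to\infty),$$ where $I\sim\mathrm{Bernoulli}(1/2)$ and $Z\sim N(0,1)$ are independent.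
   Context: This is the case $\ell=2$ of a construction in which i.i.d. uniform labels with $\ell$ possible values are placed on the vertices of a graph, and each edge receives the value $1$ if its two endpoints have equal labels and $0$ otherwise; $\xi_n$ is the number of $1$'s on the edges, standardized by its mean $n\ell^{-1}$ and standard deviation $\sqrt{n\ell^{-1}(1-\ell^{-1})}$. *)

theory Defs
  imports "HOL-Probability.Probability"
begin

definition vertices :: "nat \<Rightarrow> nat set" where
  "vertices m = {0..m+1}"

text \<open>Edges are unordered, i.e. two-element sets of vertices.\<close>

definition edges :: "nat \<Rightarrow> nat set set" where
  "edges m = (\<Union>i\<in>{1..m}. {{0, i}, {i, m+1}})"

lemma edges_vertices:
  assumes "e \<in> edges m"
  shows "e \<subseteq> vertices m" "card e = 2"
  using assms by (auto simp: edges_def vertices_def)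

lemma card_edges: "card (edges m) = 2 * m"
proof -
  let ?A = "(\<lambda>i. {0, i}) ` {1..m}" and ?B = "(\<lambda>i. {i, m+1}) ` {1..m}"
  have "card ?A = m" "card ?B = m"
    by (subst card_image; force simp: inj_on_def doubleton_eq_iff)+
  moreover have "?A \<inter> ?B = {}"
    by (auto simp: doubleton_eq_iff)
  moreover have "edges m = ?A \<union> ?B"
    by (auto simp: edges_def)
  ultimately show ?thesis
    by (simp add: card_Un_disjoint)
qed

text \<open>The value of an edge \<open>e\<close> under the vertex labelling \<open>x\<close>: all (that is, both) endpoints
  of \<open>e\<close> carry the same label or not.\<close>

definition edge_value :: "(nat \<Rightarrow> real) \<Rightarrow> nat set \<Rightarrow> real" where
  "edge_value x e = (if \<forall>i\<in>e. \<forall>j\<in>e. x i = x j then 1 else 0)"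

lemma edge_value_doubleton: "edge_value x {i, j} = (if x i = x j then 1 else 0)"
  by (auto simp: edge_value_def)

definition edge_sum :: "nat \<Rightarrow> (nat \<Rightarrow> real) \<Rightarrow> real" where
  "edge_sum m x = (\<Sum>e\<in>edges m. edge_value x e)"

definition standardized_edge_sum :: "nat \<Rightarrow> (nat \<Rightarrow> real) \<Rightarrow> real" where
  "standardized_edge_sum m x =
    (let n = card (edges m) in (edge_sum m x - real n / 2) / sqrt (real n / 4))"

text \<open>The Bernoulli distribution as a measure on the Borel sets of the reals;
  \<^const>\<open>bernoulli_pmf\<close> is a distribution on \<^typ>\<open>bool\<close>.\<close>

definition bernoulli_law :: "real \<Rightarrow> real measure" where
  "bernoulli_law p = distr (measure_pmf (bernoulli_pmf p)) borel of_bool"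

end

theory Submission
  imports Defs "HOL-Real_Asymp.Real_Asymp"
begin

text \<open>By Levy's continuity theorem it suffices to compute characteristic functions. Condition on
  the labels of the two hubs \<open>0\<close> and \<open>m + 1\<close>. If they differ, each inner vertex contributes exactly
  one to the edge sum, and the standardized sum vanishes; if they agree, it is \<open>sqrt (2 / m)\<close> times
  a sum of \<open>m\<close> independent fair signs. Hence its characteristic function at \<open>t\<close> is
  \<open>(1 + cos (t * sqrt (2 / m)) ^ m) / 2\<close>, which tends to \<open>(1 + exp (- t\<^sup>2)) / 2\<close>.\<close>

text \<open>Since \<open>cos u\<close> is \<open>1 - u\<^sup>2 / 2\<close> up to higher order, the
  logarithm of the power is \<open>n * (- c\<^sup>2 / (2 * n))\<close> plus a vanishing
  error.\<close>

lemma cos_power_tendsto: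
  fixes c :: real
  shows "(\<lambda>n. cos (c / sqrt (real n)) ^ n) \<longlonglongrightarrow> exp (- c\<^sup>2 / 2)"
proof -
  \<comment> \<open>The case split fixes the sign of the parameter \<open>c\<close>, which
    \<open>real_asymp\<close> has to know for its expansion.\<close>
  consider "c > 0" | "c = 0" | "c < 0" by linarith
  then show ?thesis
  proof cases
    case 1
    then show ?thesis by (real_asymp simp: power2_eq_square)
  next
    case 2
    then show ?thesis by simp
  next
    case 3
    then show ?thesis by (real_asymp simp: power2_eq_square)
  qed
qed

text \<open>Each inner vertex \<open>i\<close> lies on exactly two edges, one to each hub, and no
  edge arises from two inner vertices. Grouping the edges by inner vertex leaves, for fixed hub
  labels, one term per inner label.\<close>

lemma edge_sum_eq:
  "edge_sum m x = (\<Sum>i\<in>{1..m}. of_bool (x 0 = x i) + of_bool (x i = x (m + 1)))"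
proof -
  let ?A = "(\<lambda>i. {0, i}) ` {1..m}" and ?B = "(\<lambda>i. {i, m + 1}) ` {1..m}"
  have "inj_on (\<lambda>i. {0, i}) {1..m}" "inj_on (\<lambda>i. {i, m + 1}) {1..m}"
    by (auto simp: inj_on_def doubleton_eq_iff)
  moreover have "?A \<inter> ?B = {}"
    by (auto simp: doubleton_eq_iff)
  moreover have "edges m = ?A \<union> ?B"
    by (auto simp: edges_def)
  ultimately show ?thesis
    by (simp add: edge_sum_def sum.union_disjoint sum.reindex edge_value_doubleton sum.distrib
        of_bool_def)
qed

text \<open>With \<open>n = 2 * m\<close> the mean is \<open>m\<close>, which is spread as
  \<open>- 1\<close> over the \<open>m\<close> inner vertices, and the standard deviation is
  \<open>sqrt (m / 2)\<close>.\<close>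

lemma standardized_edge_sum_eq:
  assumes "m \<ge> 1"
  shows "standardized_edge_sum m x =
    (\<Sum>i\<in>{1..m}. (of_bool (x 0 = x i) + of_bool (x i = x (m + 1)) - 1) * sqrt (2 / m))"
proof -
  have "standardized_edge_sum m x = (edge_sum m x - m) * sqrt (2 / m)"
  proof -
    have scale: "sqrt (2 / m) = 1 / sqrt (real (2 * m) / 4)"
      by (subst real_sqrt_one[symmetric], subst real_sqrt_divide[symmetric]) simp
    show ?thesis
      unfolding standardized_edge_sum_def card_edges Let_def scale by simp
  qed
  then show ?thesis
    by (simp add: edge_sum_eq sum_distrib_right[symmetric] sum_subtractf)
qed

lemma measurable_standardized_edge_sum:
  assumes "m \<ge> 1" "\<And>i. i \<in> vertices m \<Longrightarrow> X i \<in> borel_measurable N"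
  shows "(\<lambda>\<omega>. standardized_edge_sum m (\<lambda>i. X i \<omega>)) \<in> borel_measurable N"
proof -
  have [measurable]: "X 0 \<in> borel_measurable N" "X (m + 1) \<in> borel_measurable N"
    using assms(2) by (simp_all add: vertices_def)
  have "(\<lambda>\<omega>. (of_bool (X 0 \<omega> = X i \<omega>) + of_bool (X i \<omega> = X (m + 1) \<omega>) - 1) * sqrt (2 / m))
      \<in> borel_measurable N" if "i \<in> {1..m}" for i
  proof -
    have [measurable]: "X i \<in> borel_measurable N"
      using assms(2) that by (simp add: vertices_def)
    show ?thesis by measurable
  qed
  then show ?thesis
    unfolding standardized_edge_sum_eq[OF assms(1)] by (rule borel_measurable_sum)
qed

lemma integral_bernoulli_law_half:
  fixes f :: "real \<Rightarrow> complex"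
  assumes X: "X \<in> borel_measurable N" and "distr N borel X = bernoulli_law (1/2)"
    and f [measurable]: "f \<in> borel_measurable borel"
  shows "(\<integral>\<omega>. f (X \<omega>) \<partial>N) = (f 0 + f 1) / 2"
proof -
  have "(\<integral>\<omega>. f (X \<omega>) \<partial>N) = (\<integral>x. f x \<partial>bernoulli_law (1/2))"
    using integral_distr[OF X f] assms(2) by simp
  also have "\<dots> = (\<integral>b. f (of_bool b) \<partial>bernoulli_pmf (1/2))"
    unfolding bernoulli_law_def by (rule integral_distr) auto
  also have "\<dots> = (f 0 + f 1) / 2"
    by (subst integral_measure_pmf[of UNIV])
      (auto simp: UNIV_bool scaleR_conv_of_real add_divide_distrib)
  finally show ?thesis .
qed

text \<open>A law constrains the values of a variable only almost surely, so every case distinction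
  on a Bernoulli variable below is an almost sure one and passes through this fact.\<close>

lemma AE_bernoulli_law:
  assumes X [measurable]: "X \<in> borel_measurable N" and "distr N borel X = bernoulli_law p"
  shows "AE \<omega> in N. X \<omega> \<in> {0, 1}"
proof -
  have "AE x in bernoulli_law p. x \<in> {0, 1}"
    unfolding bernoulli_law_def by (subst AE_distr_iff) auto
  then show ?thesis
    unfolding assms(2)[symmetric] by (subst (asm) AE_distr_iff) auto
qed

text \<open>No conditional expectation is needed: the integrand is a sum over the four pairs
  \<open>(a, b)\<close> of hub labels, and each summand is a product with one factor per vertex, so
  independence reduces its integral to integrals over single labels.\<close>

lemma char_standardized_edge_sum:
  assumes "prob_space N" and m: "m \<ge> 1"
    and indep: "prob_space.indep_vars N (\<lambda>_. borel) X (vertices m)"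
    and law: "\<And>i. i \<in> vertices m \<Longrightarrow> distr N borel (X i) = bernoulli_law (1/2)"
  shows "char (distr N borel (\<lambda>\<omega>. standardized_edge_sum m (\<lambda>i. X i \<omega>))) t =
    complex_of_real ((1 + cos (t * sqrt (2 / m)) ^ m) / 2)"
proof -
  interpret prob_space N by fact
  have rv: "X i \<in> borel_measurable N" if "i \<in> vertices m" for i
    using indep that by (auto simp: indep_vars_def)
  have ends: "0 \<in> vertices m" "m + 1 \<in> vertices m"
    and fin: "finite (vertices m)"
    by (auto simp: vertices_def)
  \<comment> \<open>\<open>h a b y\<close> is the contribution of an inner vertex labelled
    \<open>y\<close> when the hubs carry \<open>a\<close> and \<open>b\<close>; the factors
    \<open>g a b i\<close> are indicators of these labels at the hubs and exponentials of the
    contribution elsewhere.\<close>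
  define h :: "real \<Rightarrow> real \<Rightarrow> real \<Rightarrow> real"
    where "h a b y = (of_bool (a = y) + of_bool (y = b) - 1) * sqrt (2 / m)" for a b y
  define g :: "real \<Rightarrow> real \<Rightarrow> nat \<Rightarrow> real \<Rightarrow> complex"
    where "g a b i y = (if i = 0 then of_bool (y = a) else if i = m + 1 then of_bool (y = b)
      else iexp (t * h a b y))" for a b i y
  have g_meas [measurable]: "g a b i \<in> borel_measurable borel" for a b i
    unfolding g_def h_def by measurable
  have prod_vertices: "(\<Prod>i\<in>vertices m. f i) = f 0 * f (m + 1) * (\<Prod>i\<in>{1..m}. f i)"
    for f :: "nat \<Rightarrow> complex"
  proof -
    have "vertices m = insert 0 (insert (m + 1) {1..m})"
      by (auto simp: vertices_def)
    then show ?thesis by (simp add: mult.assoc)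
  qed
  \<comment> \<open>Exactly one pair \<open>(a, b)\<close> matches the hub labels; the indicators
    annihilate the other three summands.\<close>
  have split: "iexp (t * standardized_edge_sum m x) =
      (\<Sum>a\<in>{0, 1}. \<Sum>b\<in>{0, 1}. \<Prod>i\<in>vertices m. g a b i (x i))"
    if "x 0 \<in> {0, 1}" "x (m + 1) \<in> {0, 1}" for x
  proof -
    have "iexp (t * standardized_edge_sum m x) = (\<Prod>i\<in>{1..m}. iexp (t * h (x 0) (x (m + 1)) (x i)))"
      unfolding standardized_edge_sum_eq[OF m] h_def[symmetric]
      by (simp add: sum_distrib_left exp_sum)
    moreover have "(\<Prod>i\<in>vertices m. g a b i (x i)) =
      of_bool (x 0 = a) * of_bool (x (m + 1) = b) * (\<Prod>i\<in>{1..m}. iexp (t * h a b (x i)))" for a b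
      unfolding prod_vertices by (auto simp: g_def intro!: prod.cong)
    ultimately show ?thesis
      using that by auto
  qed
  have indep_g: "indep_vars (\<lambda>_. borel) (\<lambda>i \<omega>. g a b i (X i \<omega>)) (vertices m)" for a b
    by (rule indep_vars_compose2[OF indep]) simp
  have int_g: "integrable N (\<lambda>\<omega>. g a b i (X i \<omega>))" if "i \<in> vertices m" for a b i
    by (intro integrable_const_bound[of _ 1] measurable_compose[OF rv[OF that] g_meas])
      (auto simp: g_def)
  have int_prod: "(\<integral>\<omega>. (\<Prod>i\<in>vertices m. g a b i (X i \<omega>)) \<partial>N) =
      ((iexp (t * h a b 0) + iexp (t * h a b 1)) / 2) ^ m / 4"
    if "a \<in> {0, 1}" "b \<in> {0, 1}" for a b
  proof -
    have "(\<integral>\<omega>. (\<Prod>i\<in>vertices m. g a b i (X i \<omega>)) \<partial>N) =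
        (\<Prod>i\<in>vertices m. \<integral>\<omega>. g a b i (X i \<omega>) \<partial>N)"
      by (rule indep_vars_lebesgue_integral[OF fin indep_g int_g])
    also have "\<dots> = (\<Prod>i\<in>vertices m. (g a b i 0 + g a b i 1) / 2)"
      by (intro prod.cong refl integral_bernoulli_law_half rv law g_meas)
    \<comment> \<open>Each hub indicator averages to \<open>1 / 2\<close>, as \<open>a\<close> and
      \<open>b\<close> are possible labels; together they give the probability \<open>1 / 4\<close>
      of the pair.\<close>
    also have "\<dots> = 1 / 4 * (\<Prod>i\<in>{1..m}. (iexp (t * h a b 0) + iexp (t * h a b 1)) / 2)"
      unfolding prod_vertices using that by (intro arg_cong2[where f="(*)"] prod.cong) (auto simp: g_def)
    finally show ?thesis by simp
  qed
  have "char (distr N borel (\<lambda>\<omega>. standardized_edge_sum m (\<lambda>i. X i \<omega>))) t =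
      (\<integral>\<omega>. iexp (t * standardized_edge_sum m (\<lambda>i. X i \<omega>)) \<partial>N)"
    unfolding char_def
    by (rule integral_distr) (use measurable_standardized_edge_sum[OF m rv] in auto)
  also have "\<dots> = (\<integral>\<omega>. (\<Sum>a\<in>{0, 1}. \<Sum>b\<in>{0, 1}. \<Prod>i\<in>vertices m. g a b i (X i \<omega>)) \<partial>N)"
  proof (rule integral_cong_AE)
    show "AE \<omega> in N. iexp (t * standardized_edge_sum m (\<lambda>i. X i \<omega>)) =
        (\<Sum>a\<in>{0, 1}. \<Sum>b\<in>{0, 1}. \<Prod>i\<in>vertices m. g a b i (X i \<omega>))"
      using AE_bernoulli_law[OF rv law, OF ends(1) ends(1)]
        AE_bernoulli_law[OF rv law, OF ends(2) ends(2)]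
      by eventually_elim (rule split)
    show "(\<lambda>\<omega>. iexp (t * standardized_edge_sum m (\<lambda>i. X i \<omega>))) \<in> borel_measurable N"
      using measurable_standardized_edge_sum[OF m rv] by measurable
    show "(\<lambda>\<omega>. \<Sum>a\<in>{0, 1}. \<Sum>b\<in>{0, 1}. \<Prod>i\<in>vertices m. g a b i (X i \<omega>)) \<in> borel_measurable N"
      by (intro borel_measurable_sum borel_measurable_prod measurable_compose[OF rv g_meas])
  qed
  also have "\<dots> = (\<Sum>a\<in>{0, 1}. \<Sum>b\<in>{0, 1}. \<integral>\<omega>. (\<Prod>i\<in>vertices m. g a b i (X i \<omega>)) \<partial>N)"
  proof -
    have "integrable N (\<lambda>\<omega>. \<Prod>i\<in>vertices m. g a b i (X i \<omega>))" for a b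
      by (rule indep_vars_integrable[OF fin indep_g int_g])
    then show ?thesis
      by (simp only: Bochner_Integration.integral_sum Bochner_Integration.integrable_sum)
  qed
  also have "\<dots> = (\<Sum>a\<in>{0, 1}. \<Sum>b\<in>{0, 1}. ((iexp (t * h a b 0) + iexp (t * h a b 1)) / 2) ^ m / 4)"
    by (intro sum.cong refl int_prod)
  \<comment> \<open>For \<open>a = b\<close> the two values of \<open>h\<close> are
    \<open>sqrt (2 / m)\<close> and its negative, so the exponentials average to a cosine; for
    \<open>a \<noteq> b\<close> both values are 0 and the average is 1. Each case accounts for two
    of the four pairs.\<close>
  also have "\<dots> = complex_of_real ((1 + cos (t * sqrt (2 / m)) ^ m) / 2)"
    by (simp add: h_def cos_exp_eq cos_of_real[symmetric] add.commute)
  finally show ?thesis .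
qed

text \<open>The exponential is 1 where \<open>I\<close> vanishes and \<open>iexp (c * t * Z)\<close>
  where \<open>I\<close> is 1. Both events have probability one half, and by independence the second
  contributes half the normal characteristic function at \<open>c * t\<close>.\<close>

lemma char_bernoulli_times_normal:
  assumes "prob_space Q" and indep: "prob_space.indep_var Q borel I borel Z"
    and law_I: "distr Q borel I = bernoulli_law (1/2)"
    and law_Z: "distributed Q lborel Z std_normal_density"
  shows "char (distr Q borel (\<lambda>\<omega>. c * I \<omega> * Z \<omega>)) t =
    complex_of_real ((1 + exp (- (c * t)\<^sup>2 / 2)) / 2)"
proof -
  interpret prob_space Q by fact
  have rv [measurable]: "I \<in> borel_measurable Q" "Z \<in> borel_measurable Q"
    using indep by (auto dest: indep_var_rv1 indep_var_rv2)
  let ?f = "\<lambda>y::real. of_bool (y = 1) :: complex" and ?g = "\<lambda>z::real. iexp (c * t * z)"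
  have meas [measurable]: "?f \<in> borel_measurable borel" "?g \<in> borel_measurable borel"
    by measurable
  have indep': "indep_var borel (\<lambda>\<omega>. ?f (I \<omega>)) borel (\<lambda>\<omega>. ?g (Z \<omega>))"
    using indep_var_compose[OF indep meas] by (simp add: comp_def)
  have int: "integrable Q (\<lambda>\<omega>. ?f (I \<omega>))" "integrable Q (\<lambda>\<omega>. ?g (Z \<omega>))"
    "integrable Q (\<lambda>\<omega>. (of_bool (I \<omega> = 0) :: complex))"
    by (rule integrable_const_bound[of _ 1]; simp)+
  \<comment> \<open>\<open>distributed\<close> speaks of the image measure on \<open>lborel\<close>;
    it agrees with the one on \<open>borel\<close> because the two have the same measurable
    sets.\<close>
  have "distr Q borel Z = std_normal_distribution"
    using distributed_distr_eq_density[OF law_Z] by (simp cong: distr_cong)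
  then have char_Z: "(\<integral>\<omega>. ?g (Z \<omega>) \<partial>Q) = exp (- (c * t)\<^sup>2 / 2)"
    using integral_distr[OF rv(2) meas(2)] fun_cong[OF char_std_normal_distribution, of "c * t"]
    by (simp add: char_def)
  have "char (distr Q borel (\<lambda>\<omega>. c * I \<omega> * Z \<omega>)) t = (\<integral>\<omega>. iexp (t * (c * I \<omega> * Z \<omega>)) \<partial>Q)"
    unfolding char_def by (rule integral_distr) auto
  also have "\<dots> = (\<integral>\<omega>. of_bool (I \<omega> = 0) + ?f (I \<omega>) * ?g (Z \<omega>) \<partial>Q)"
  proof (rule integral_cong_AE)
    show "AE \<omega> in Q. iexp (t * (c * I \<omega> * Z \<omega>)) = of_bool (I \<omega> = 0) + ?f (I \<omega>) * ?g (Z \<omega>)"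
      using AE_bernoulli_law[OF rv(1) law_I] by eventually_elim (auto simp: mult_ac)
  qed measurable
  also have "\<dots> = (\<integral>\<omega>. of_bool (I \<omega> = 0) \<partial>Q) + (\<integral>\<omega>. ?f (I \<omega>) \<partial>Q) * (\<integral>\<omega>. ?g (Z \<omega>) \<partial>Q)"
    using indep_var_integrable[OF indep' int(1,2)] indep_var_lebesgue_integral[OF indep' int(1,2)] int(3)
    by (subst Bochner_Integration.integral_add) auto
  also have "(\<integral>\<omega>. of_bool (I \<omega> = 0) \<partial>Q) = (1 / 2 :: complex)"
    by (subst integral_bernoulli_law_half[OF rv(1) law_I]) auto
  also have "(\<integral>\<omega>. ?f (I \<omega>) \<partial>Q) = 1 / 2"
    by (subst integral_bernoulli_law_half[OF rv(1) law_I]) auto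
  finally show ?thesis
    unfolding char_Z by (simp add: add_divide_distrib)
qed

theorem theorem4p2:
  fixes P :: "nat \<Rightarrow> 'a measure" and M :: "nat \<Rightarrow> nat \<Rightarrow> 'a \<Rightarrow> real"
    and Q :: "'b measure" and I Z :: "'b \<Rightarrow> real"
  assumes "\<And>m. m \<ge> 1 \<Longrightarrow> prob_space (P m)"
    and "\<And>m. m \<ge> 1 \<Longrightarrow> prob_space.indep_vars (P m) (\<lambda>_. borel) (M m) (vertices m)"
    and "\<And>m i. m \<ge> 1 \<Longrightarrow> i \<in> vertices m \<Longrightarrow> distr (P m) borel (M m i) = bernoulli_law (1/2)"
    and "prob_space Q"
    and "prob_space.indep_var Q borel I borel Z"
    and "distr Q borel I = bernoulli_law (1/2)"
    and "distributed Q lborel Z std_normal_density"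
  shows "weak_conv_m
           (\<lambda>m. distr (P m) borel (\<lambda>\<omega>. standardized_edge_sum m (\<lambda>i. M m i \<omega>)))
           (distr Q borel (\<lambda>\<omega>. sqrt 2 * I \<omega> * Z \<omega>))"
proof -
  let ?\<mu> = "\<lambda>m. distr (P m) borel (\<lambda>\<omega>. standardized_edge_sum m (\<lambda>i. M m i \<omega>))"
  let ?\<nu> = "distr Q borel (\<lambda>\<omega>. sqrt 2 * I \<omega> * Z \<omega>)"
  interpret Q: prob_space Q by fact
  have [measurable]: "I \<in> borel_measurable Q" "Z \<in> borel_measurable Q"
    using assms(5) by (auto dest: Q.indep_var_rv1 Q.indep_var_rv2)
  \<comment> \<open>The hypotheses concern only \<open>m \<ge> 1\<close>, whereas the continuity
    theorem asks for a probability distribution at every index; hence the shift by one.\<close>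
  have "weak_conv_m (\<lambda>m. ?\<mu> (Suc m)) ?\<nu>"
  proof (rule levy_continuity)
    show "real_distribution (?\<mu> (Suc m))" for m
    proof -
      interpret prob_space "P (Suc m)" using assms(1) by simp
      have "M (Suc m) i \<in> borel_measurable (P (Suc m))" if "i \<in> vertices (Suc m)" for i
        using assms(2)[of "Suc m"] that by (auto simp: indep_vars_def)
      then show ?thesis
        by (intro real_distribution_distr measurable_standardized_edge_sum) auto
    qed
    show "real_distribution ?\<nu>"
      by (intro Q.real_distribution_distr) measurable
    show "(\<lambda>m. char (?\<mu> (Suc m)) t) \<longlonglongrightarrow> char ?\<nu> t" for t
    proof -
      have "char (?\<mu> (Suc m)) t =
          complex_of_real ((1 + cos (t * sqrt (2 / Suc m)) ^ Suc m) / 2)" for m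
        using assms(1-3)[of "Suc m"] by (intro char_standardized_edge_sum) auto
      moreover have "char ?\<nu> t = complex_of_real ((1 + exp (- t\<^sup>2)) / 2)"
        using char_bernoulli_times_normal[OF assms(4-7), of "sqrt 2" t]
        by (simp add: power_mult_distrib)
      \<comment> \<open>Here \<open>c = t * sqrt 2\<close> is the choice for which
        \<open>c / sqrt n\<close> is the argument of the cosine and
        \<open>c\<^sup>2 / 2 = t\<^sup>2\<close>.\<close>
      moreover have "(\<lambda>m. cos (t * sqrt (2 / Suc m)) ^ Suc m) \<longlonglongrightarrow> exp (- t\<^sup>2)"
        using LIMSEQ_Suc[OF cos_power_tendsto[of "t * sqrt 2"]]
        by (simp add: real_sqrt_divide power_mult_distrib)
      ultimately show ?thesis
        by (simp only:) (intro tendsto_intros; simp)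
    qed
  qed
  \<comment> \<open>Weak convergence is convergence of real sequences of distribution function
    values at continuity points of the limit, and there the shift can be undone.\<close>
  then show ?thesis
    unfolding weak_conv_m_def weak_conv_def by (auto intro: LIMSEQ_imp_Suc)
qed

end
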